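(* There exist absolute constants $0<c\le C$ such that for all positive integers $n$ and $k$ with $1\le k\le \left(\frac{n-2}{2}\right)^2$ we have $$c\,n\sqrt{k}\ \le\ \overline{\max}\, S_k(K_n)\ \le\ C\,n\sqrt{k},$$ i.e. $\overline{\max}\, S_k(K_n)=\Theta(n\sqrt k)$.
   Context: All graphs are simple and finite. A rectilinear drawing $\mathcal D$ of a graph represents the vertices by distinct points in the plane in general position (no three collinear) and every edge by the line segment joining its endpoints, with no three edges sharing an interior point. A crossing of $\mathcal D$ is a common interior point of two distinct edges. For an integer $k\ge 0$, $S_k(\mathcal D)$ is the number of edges of $\mathcal D$ that are involved in at most $k$ crossings. $\overline{\max}\, S_k(G)$ is the maximum of $S_k(\mathcal D)$ over all rectilinear drawings $\mathcal D$ of $G$. *)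

theory Defs
  imports "HOL-Analysis.Analysis"
begin

(* A graph is given by its vertex set V and its edge set E; edges are
   two-element sets of vertices. *)

definition finite_simple_graph :: "'a set \<Rightarrow> 'a set set \<Rightarrow> bool" where
  "finite_simple_graph V E \<longleftrightarrow> finite V \<and> (\<forall>e\<in>E. e \<subseteq> V \<and> card e = 2)"

definition complete_vertices :: "nat \<Rightarrow> nat set" where
  "complete_vertices n = {..<n}"

definition complete_edges :: "nat \<Rightarrow> nat set set" where
  "complete_edges n = {e. e \<subseteq> complete_vertices n \<and> card e = 2}"

lemma finite_simple_graph_complete:
  "finite_simple_graph (complete_vertices n) (complete_edges n)"
  by (auto simp: finite_simple_graph_def complete_vertices_def complete_edges_def)

(* A drawing is determined by the placement p of the vertices. *)

definition edge_interior :: "('a \<Rightarrow> real ^ 2) \<Rightarrow> 'a set \<Rightarrow> (real ^ 2) set" where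
  "edge_interior p e = {x. \<exists>u v. e = {u, v} \<and> x \<in> open_segment (p u) (p v)}"

definition rectilinear_drawing ::
    "'a set \<Rightarrow> 'a set set \<Rightarrow> ('a \<Rightarrow> real ^ 2) \<Rightarrow> bool" where
  "rectilinear_drawing V E p \<longleftrightarrow>
     inj_on p V \<and>
     (\<forall>u\<in>V. \<forall>v\<in>V. \<forall>w\<in>V. u \<noteq> v \<longrightarrow> u \<noteq> w \<longrightarrow> v \<noteq> w \<longrightarrow> \<not> collinear {p u, p v, p w}) \<and>
     (\<forall>e\<in>E. \<forall>f\<in>E. \<forall>g\<in>E. e \<noteq> f \<longrightarrow> e \<noteq> g \<longrightarrow> f \<noteq> g \<longrightarrow>
        edge_interior p e \<inter> edge_interior p f \<inter> edge_interior p g = {})"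

(* In a rectilinear drawing of a finite simple graph this set is finite, since
   two distinct edges have at most one common interior point; and as no three
   edges share an interior point, each crossing belongs to exactly two edges. *)
definition crossings_on ::
    "'a set set \<Rightarrow> ('a \<Rightarrow> real ^ 2) \<Rightarrow> 'a set \<Rightarrow> (real ^ 2) set" where
  "crossings_on E p e = {x. \<exists>f\<in>E. f \<noteq> e \<and> x \<in> edge_interior p e \<inter> edge_interior p f}"

definition S_edges :: "nat \<Rightarrow> 'a set set \<Rightarrow> ('a \<Rightarrow> real ^ 2) \<Rightarrow> nat" where
  "S_edges k E p = card {e \<in> E. card (crossings_on E p e) \<le> k}"

(* For finite E the set of values is finite, being bounded by card E. *)
definition max_S :: "nat \<Rightarrow> 'a set \<Rightarrow> 'a set set \<Rightarrow> nat" where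
  "max_S k V E = Max {S_edges k E p | p. rectilinear_drawing V E p}"

end

theory Submission
  imports Defs
begin

text \<open>
  Upper bound: in a complete geometric graph on a point set $S$ at most $3|S|$ edges are uncrossed.
  Order the points lexicographically. Of three right neighbours of $u$ along uncrossed edges one, $v$,
  lies in the triangle spanned by $u$ and the other two. If a further edge $wv$ is uncrossed, it
  cannot leave this triangle, so $u$ precedes $w$; hence no point is such a middle neighbour for two
  different $u$. Choosing vertices at random with probability $1/\sqrt{2k}$, as in
  the proof of the crossing lemma, turns $3|S|$ into $12n\sqrt k$.

  Lower bound: split the points, ordered from left to right, into blocks of about $\sqrt k$ points
  such that triples within one block turn clockwise and all other triples turn counterclockwise. An
  edge within a block is then crossed only by edges of the same block. This is an open condition,
  so the points can be moved into a position where no three edges are concurrent.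
\<close>

subsection \<open>Orientation and crossing edges\<close>

text \<open>Twice the signed area of the triangle \<open>a b c\<close>, positive for a
  counterclockwise turn.\<close>

definition orient :: "real ^ 2 \<Rightarrow> real ^ 2 \<Rightarrow> real ^ 2 \<Rightarrow> real" where
  "orient a b c = (b$1 - a$1) * (c$2 - a$2) - (b$2 - a$2) * (c$1 - a$1)"

lemma vec2_eq_iff: "x = y \<longleftrightarrow> x$1 = y$1 \<and> x$2 = y$2" for x y :: "real ^ 2"
  by (simp add: vec_eq_iff forall_2)

lemma orient_cyclic: "orient b c a = orient a b c"
  by (simp add: orient_def algebra_simps)

lemma orient_swap: "orient b a c = - orient a b c" "orient a c b = - orient a b c"
  by (simp_all add: orient_def algebra_simps)

lemma orient_same [simp]: "orient a a b = 0" "orient a b a = 0" "orient a b b = 0"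
  by (simp_all add: orient_def algebra_simps)

lemma orient_convex:
  "orient a b ((1 - t) *\<^sub>R c + t *\<^sub>R d) = (1 - t) * orient a b c + t * orient a b d"
  by (simp add: orient_def algebra_simps)

lemma orient_open_segment:
  assumes "z \<in> open_segment a b"
  shows "orient a b z = 0"
  using assms by (auto simp: in_segment orient_convex)

text \<open>Each coordinate of \<open>d - c\<close>, times \<open>orient a b c\<close>, is a
  combination of the two vanishing orientations, and one of these coordinates is nonzero.\<close>

lemma orient_exchange:
  assumes "orient c d a = 0" "orient c d b = 0" "c \<noteq> d"
  shows "orient a b c = 0"
proof -
  have "(d$1 - c$1) * orient a b c = (a$1 - c$1) * orient c d b - (b$1 - c$1) * orient c d a"
       "(d$2 - c$2) * orient a b c = (a$2 - c$2) * orient c d b - (b$2 - c$2) * orient c d a"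
    by (simp_all add: orient_def algebra_simps)
  with assms show ?thesis by (auto simp: vec2_eq_iff)
qed

lemma collinear_iff_orient: "collinear {a, b, c} \<longleftrightarrow> orient a b c = 0"
proof
  assume "collinear {a, b, c}"
  then obtain w where w: "\<forall>x\<in>{a,b,c}. \<forall>y\<in>{a,b,c}. \<exists>r. x - y = r *\<^sub>R w"
    unfolding collinear_def by blast
  then obtain r s where "b - a = r *\<^sub>R w" "c - a = s *\<^sub>R w" by blast
  then have "b$1 - a$1 = r * w$1" "b$2 - a$2 = r * w$2" "c$1 - a$1 = s * w$1" "c$2 - a$2 = s * w$2"
    by (metis vector_minus_component vector_scaleR_component real_scaleR_def)+
  then show "orient a b c = 0" by (simp add: orient_def)
next
  assume o: "orient a b c = 0"
  show "collinear {a, b, c}"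
  proof (cases "a = b")
    case True
    then show ?thesis by simp
  next
    case False
    \<comment> \<open>\<open>N\<close> is the squared length of \<open>b - a\<close>, and
      \<open>r\<close> the coefficient of the orthogonal projection of \<open>c - a\<close> onto
      \<open>b - a\<close>; the residual is a multiple of \<open>orient a b c\<close>.\<close>
    define N where "N = (b$1 - a$1)^2 + (b$2 - a$2)^2"
    define r where "r = ((c$1 - a$1) * (b$1 - a$1) + (c$2 - a$2) * (b$2 - a$2)) / N"
    have N: "N \<noteq> 0" using False by (auto simp: N_def vec2_eq_iff sum_power2_eq_zero_iff)
    have "N * (c$1 - a$1) - N * r * (b$1 - a$1) = - (b$2 - a$2) * orient a b c"
         "N * (c$2 - a$2) - N * r * (b$2 - a$2) = (b$1 - a$1) * orient a b c"
      using N by (simp_all add: r_def, simp_all add: N_def orient_def power2_eq_square algebra_simps)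
    then have "N * (c$1 - a$1) = N * (r * (b$1 - a$1))" "N * (c$2 - a$2) = N * (r * (b$2 - a$2))"
      using o by (simp_all add: mult.assoc)
    then have "c$1 - a$1 = r * (b$1 - a$1)" "c$2 - a$2 = r * (b$2 - a$2)"
      using N by simp_all
    then have "c - a = r *\<^sub>R (b - a)"
      by (simp add: vec2_eq_iff)
    then have "collinear {0, b - a, c - a}" unfolding collinear_lemma by blast
    then have "collinear {b, a, c}" by (subst collinear_3) auto
    then show ?thesis by (simp add: insert_commute)
  qed
qed

text \<open>\<open>orient c d\<close> is affine along the line \<open>a b\<close>. With two zeros,
  at \<open>x\<close> and \<open>y\<close>, it vanishes at \<open>a\<close> and \<open>b\<close> as
  well, which makes \<open>a\<close>, \<open>b\<close>, \<open>c\<close> collinear.\<close>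

lemma open_segments_meet_once:
  assumes "orient a b c \<noteq> 0"
    and x: "x \<in> open_segment a b" "x \<in> open_segment c d"
    and y: "y \<in> open_segment a b" "y \<in> open_segment c d"
  shows "x = y"
proof (rule ccontr)
  assume "x \<noteq> y"
  have cd: "c \<noteq> d" using x(2) by auto
  have 0: "orient c d x = 0" "orient c d y = 0"
    using x y orient_open_segment by blast+
  obtain s t where s: "x = (1 - s) *\<^sub>R a + s *\<^sub>R b" and t: "y = (1 - t) *\<^sub>R a + t *\<^sub>R b"
    using x(1) y(1) by (auto simp: in_segment)
  with \<open>x \<noteq> y\<close> have "s \<noteq> t" by auto
  have 1: "(1 - s) * orient c d a + s * orient c d b = 0" "(1 - t) * orient c d a + t * orient c d b = 0"
    using 0 by (simp_all add: s t orient_convex)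
  have E: "(s - t) * orient c d a = s * ((1 - t) * orient c d a + t * orient c d b) - t * ((1 - s) * orient c d a + s * orient c d b)"
       "(s - t) * orient c d b = (1 - t) * ((1 - s) * orient c d a + s * orient c d b) - (1 - s) * ((1 - t) * orient c d a + t * orient c d b)"
    by (simp_all add: algebra_simps)
  have "(s - t) * orient c d a = 0" "(s - t) * orient c d b = 0"
    by (simp_all only: E 1 mult_zero_right diff_self)
  then have "orient c d a = 0" "orient c d b = 0" using \<open>s \<noteq> t\<close> by auto
  then show False using orient_exchange cd assms(1) by blast
qed

text \<open>\<open>orient c d\<close> is affine, so it keeps its sign between \<open>a\<close> and
  \<open>b\<close>, whereas it vanishes on \<open>open_segment c d\<close>.\<close>

lemma same_side_disjoint:
  assumes "orient c d a * orient c d b > 0"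
  shows "open_segment a b \<inter> open_segment c d = {}"
proof -
  have False if z: "z \<in> open_segment a b" "z \<in> open_segment c d" for z
  proof -
    obtain t where t: "0 < t" "t < 1" "z = (1 - t) *\<^sub>R a + t *\<^sub>R b"
      using z(1) by (auto simp: in_segment)
    have "(1 - t) * orient c d a + t * orient c d b = 0"
      using orient_open_segment[OF z(2)] by (simp add: t(3) orient_convex)
    moreover from assms have "(orient c d a > 0 \<and> orient c d b > 0) \<or> (orient c d a < 0 \<and> orient c d b < 0)"
      by (auto simp: zero_less_mult_iff)
    moreover have "1 - t > 0" using t by simp
    ultimately show False using t(1)
      by (metis add_neg_neg add_pos_pos mult_pos_neg mult_pos_pos order_less_irrefl)
  qed
  then show ?thesis by blast
qed

section \<open>Complete geometric graphs in general position\<close>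

lemma edge_interior_pair [simp]: "edge_interior p {u, v} = open_segment (p u) (p v)"
  by (auto simp: edge_interior_def doubleton_eq_iff open_segment_commute)

definition pairs :: "'a set \<Rightarrow> 'a set set" where
  "pairs S = {e. e \<subseteq> S \<and> card e = 2}"

lemma pairsE:
  assumes "e \<in> pairs S"
  obtains u v where "e = {u, v}" "u \<noteq> v" "u \<in> S" "v \<in> S"
  using assms unfolding pairs_def card_2_iff by blast

lemma pair_in_pairs_iff [simp]: "{u, v} \<in> pairs S \<longleftrightarrow> u \<in> S \<and> v \<in> S \<and> u \<noteq> v"
  by (auto simp: pairs_def)

lemma pairs_mono: "S \<subseteq> T \<Longrightarrow> pairs S \<subseteq> pairs T"
  by (auto simp: pairs_def)

lemma finite_pairs [simp]: "finite S \<Longrightarrow> finite (pairs S)"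
  by (auto simp: pairs_def)

lemma complete_edges_eq: "complete_edges n = pairs {..<n}"
  by (simp add: complete_edges_def complete_vertices_def pairs_def)

definition general_position :: "'a set \<Rightarrow> ('a \<Rightarrow> real ^ 2) \<Rightarrow> bool" where
  "general_position V p \<longleftrightarrow>
     (\<forall>u\<in>V. \<forall>v\<in>V. \<forall>w\<in>V. u \<noteq> v \<longrightarrow> u \<noteq> w \<longrightarrow> v \<noteq> w \<longrightarrow> orient (p u) (p v) (p w) \<noteq> 0)"

lemma general_positionD:
  "\<lbrakk>general_position V p; u \<in> V; v \<in> V; w \<in> V; u \<noteq> v; u \<noteq> w; v \<noteq> w\<rbrakk> \<Longrightarrow> orient (p u) (p v) (p w) \<noteq> 0"
  by (auto simp: general_position_def)

lemma general_position_subset: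
  "general_position V p \<Longrightarrow> S \<subseteq> V \<Longrightarrow> general_position S p"
  unfolding general_position_def by blast

lemma rectilinear_drawing_iff:
  "rectilinear_drawing V E p \<longleftrightarrow> inj_on p V \<and> general_position V p \<and>
     (\<forall>e\<in>E. \<forall>f\<in>E. \<forall>g\<in>E. e \<noteq> f \<longrightarrow> e \<noteq> g \<longrightarrow> f \<noteq> g \<longrightarrow>
        edge_interior p e \<inter> edge_interior p f \<inter> edge_interior p g = {})"
  by (simp add: rectilinear_drawing_def general_position_def collinear_iff_orient)

lemma edges_meet_once:
  assumes "general_position V p" "e \<in> pairs V" "f \<in> pairs V" "e \<noteq> f"
    and "x \<in> edge_interior p e \<inter> edge_interior p f" "y \<in> edge_interior p e \<inter> edge_interior p f"
  shows "x = y"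
proof -
  obtain a b where ab: "e = {a, b}" "a \<noteq> b" "a \<in> V" "b \<in> V" using assms(2) by (rule pairsE)
  obtain c d where cd: "f = {c, d}" "c \<noteq> d" "c \<in> V" "d \<in> V" "c \<notin> {a, b}"
    using assms(3,4) ab(1,2) by (elim pairsE) (metis doubleton_eq_iff insert_iff singletonD)
  have "orient (p a) (p b) (p c) \<noteq> 0"
    using general_positionD[OF assms(1), of a b c] ab cd by auto
  then show ?thesis
    using open_segments_meet_once[of "p a" "p b" "p c" x "p d" y] assms(5,6) ab(1) cd(1) by simp
qed

text \<open>An interior point common to \<open>{a, b}\<close> and \<open>{a, c}\<close> differs from
  \<open>a\<close>, so both edges would lie on the line through it and \<open>a\<close>.\<close>

lemma crossing_edges_disjoint:
  assumes "general_position V p" "e \<in> pairs V" "f \<in> pairs V" "e \<noteq> f"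
    and "edge_interior p e \<inter> edge_interior p f \<noteq> {}"
  shows "e \<inter> f = {}"
proof (rule ccontr)
  assume "e \<inter> f \<noteq> {}"
  then obtain a where a: "a \<in> e" "a \<in> f" by blast
  obtain b where b: "e = {a, b}" "a \<noteq> b" "a \<in> V" "b \<in> V"
    using assms(2) a(1) by (elim pairsE) (auto simp: insert_commute)
  obtain c where c: "f = {a, c}" "a \<noteq> c" "c \<in> V"
    using assms(3) a(2) by (elim pairsE) (auto simp: insert_commute)
  have bc: "b \<noteq> c" using assms(4) b c by auto
  obtain z where z: "z \<in> open_segment (p a) (p b)" "z \<in> open_segment (p a) (p c)"
    using assms(5) b c by auto
  have "z \<noteq> p a" using z by (auto simp: open_segment_def)
  then have "orient (p b) (p c) (p a) = 0"
    using orient_exchange[of "p a" z "p b" "p c"] orient_open_segment[OF z(1)] orient_open_segment[OF z(2)]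
    by (metis add.inverse_neutral orient_swap(2))
  then show False
    using general_positionD[OF assms(1), of b c a] b c bc by auto
qed

subsection \<open>Triangles and the lexicographic order\<close>

text \<open>The second coordinate breaks ties because general position allows two points on a
  vertical line.\<close>

definition lex_less :: "real ^ 2 \<Rightarrow> real ^ 2 \<Rightarrow> bool" where
  "lex_less a b \<longleftrightarrow> a$1 < b$1 \<or> (a$1 = b$1 \<and> a$2 < b$2)"

lemma lex_less_linear: "a \<noteq> b \<Longrightarrow> lex_less a b \<or> lex_less b a"
  by (auto simp: lex_less_def vec2_eq_iff)

lemma lex_less_asym: "lex_less a b \<Longrightarrow> \<not> lex_less b a"
  by (auto simp: lex_less_def)

text \<open>Strictly positive barycentric coordinates: for noncollinear corners this is the open
  triangle.\<close>

definition in_triangle :: "real ^ 2 \<Rightarrow> real ^ 2 \<Rightarrow> real ^ 2 \<Rightarrow> real ^ 2 \<Rightarrow> bool" where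
  "in_triangle a b c z \<longleftrightarrow>
     (\<exists>r s t. r > 0 \<and> s > 0 \<and> t > 0 \<and> r + s + t = 1 \<and> z = r *\<^sub>R a + s *\<^sub>R b + t *\<^sub>R c)"

text \<open>\<open>z - u\<close> is a positive combination of \<open>a - u\<close> and
  \<open>b - u\<close>, and the lexicographically positive vectors form a convex cone.\<close>

lemma lex_less_in_triangle:
  assumes "lex_less u a" "lex_less u b" "in_triangle u a b z"
  shows "lex_less u z"
proof -
  obtain r s t where *: "r > 0" "s > 0" "t > 0" "r + s + t = 1" "z = r *\<^sub>R u + s *\<^sub>R a + t *\<^sub>R b"
    using assms(3) by (auto simp: in_triangle_def)
  have r: "r = 1 - s - t" using *(4) by simp
  have z: "z$1 - u$1 = s * (a$1 - u$1) + t * (b$1 - u$1)" "z$2 - u$2 = s * (a$2 - u$2) + t * (b$2 - u$2)"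
    by (simp_all add: *(5) r algebra_simps)
  have pos: "0 \<le> s * x + t * y" "x > 0 \<or> y > 0 \<Longrightarrow> 0 < s * x + t * y" if "0 \<le> x" "0 \<le> y" for x y :: real
    using that *(2,3) by (auto intro: add_pos_nonneg add_nonneg_pos)
  have "a$1 - u$1 \<ge> 0" "b$1 - u$1 \<ge> 0" using assms by (auto simp: lex_less_def)
  note p1 = pos[OF this]
  show ?thesis
  proof (cases "a$1 > u$1 \<or> b$1 > u$1")
    case True
    then have "z$1 - u$1 > 0" using p1(2) z(1) by auto
    then show ?thesis by (simp add: lex_less_def)
  next
    case False
    then have "a$1 = u$1" "b$1 = u$1" "a$2 > u$2" "b$2 > u$2" using assms by (auto simp: lex_less_def)
    then have "z$1 = u$1" "z$2 - u$2 > 0" using z pos(2)[of "a$2 - u$2" "b$2 - u$2"] by auto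
    then show ?thesis by (simp add: lex_less_def)
  qed
qed

text \<open>Seen from \<open>u\<close> the points lie in a half-plane, where counterclockwise
  turning is transitive. The identities \<open>id\<close> write a multiple of \<open>b - u\<close>
  as a positive combination of \<open>a - u\<close> and \<open>c - u\<close>.\<close>

lemma no_cyclic_turn:
  assumes "lex_less u a" "lex_less u b" "lex_less u c"
    and "orient u a b > 0" "orient u b c > 0"
  shows "orient u a c > 0"
proof (rule ccontr)
  assume n: "\<not> orient u a c > 0"
  have id: "orient u a c * (b$1 - u$1) = orient u b c * (a$1 - u$1) + orient u a b * (c$1 - u$1)"
       "orient u a c * (b$2 - u$2) = orient u b c * (a$2 - u$2) + orient u a b * (c$2 - u$2)"
    by (simp_all add: orient_def algebra_simps)
  have nonneg: "a$1 - u$1 \<ge> 0" "b$1 - u$1 \<ge> 0" "c$1 - u$1 \<ge> 0" using assms by (auto simp: lex_less_def)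
  have "orient u a c * (b$1 - u$1) \<le> 0" using n nonneg by (simp add: mult_nonpos_nonneg)
  moreover have "orient u b c * (a$1 - u$1) \<ge> 0" "orient u a b * (c$1 - u$1) \<ge> 0"
    using nonneg assms by simp_all
  ultimately have "orient u b c * (a$1 - u$1) = 0" "orient u a b * (c$1 - u$1) = 0" "orient u a c * (b$1 - u$1) = 0"
    using id(1) by linarith+
  then have eq: "a$1 = u$1" "c$1 = u$1" using assms by auto
  then have pos: "a$2 > u$2" "c$2 > u$2" using assms by (auto simp: lex_less_def)
  have "orient u a c = 0" using eq by (simp add: orient_def)
  moreover have "orient u b c * (a$2 - u$2) > 0" "orient u a b * (c$2 - u$2) > 0" using pos assms by simp_all
  ultimately show False using id(2) by simp
qed

text \<open>The point \<open>c\<close> lies in the cone at \<open>u\<close> spanned by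
  \<open>a\<close> and \<open>b\<close>, so \<open>c - u\<close> has positive coefficients
  \<open>s\<close> and \<open>t\<close> in \<open>a - u\<close> and \<open>b - u\<close>. It lies
  before the line \<open>a b\<close> if \<open>s + t < 1\<close> and beyond it if
  \<open>s + t > 1\<close>.\<close>

lemma between_in_triangle_or_crosses:
  assumes "orient u a c > 0" "orient u c b > 0" "orient u a b > 0" "orient a b c \<noteq> 0"
  shows "in_triangle u a b c \<or> open_segment u c \<inter> open_segment a b \<noteq> {}"
proof -
  define D where "D = orient u a b"
  define s where "s = orient u c b / D"
  define t where "t = orient u a c / D"
  have D: "D > 0" using assms D_def by simp
  have st: "s > 0" "t > 0" using assms D by (simp_all add: s_def t_def)
  have Dst: "D * s = orient u c b" "D * t = orient u a c" using D by (simp_all add: s_def t_def)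
  have "D * (c$1 - u$1) = D * s * (a$1 - u$1) + D * t * (b$1 - u$1)"
       "D * (c$2 - u$2) = D * s * (a$2 - u$2) + D * t * (b$2 - u$2)"
    unfolding Dst by (simp_all add: D_def orient_def algebra_simps)
  then have "D * (c$1 - u$1) = D * (s * (a$1 - u$1) + t * (b$1 - u$1))"
       "D * (c$2 - u$2) = D * (s * (a$2 - u$2) + t * (b$2 - u$2))" by (simp_all add: algebra_simps)
  then have "c$1 - u$1 = s * (a$1 - u$1) + t * (b$1 - u$1)"
       "c$2 - u$2 = s * (a$2 - u$2) + t * (b$2 - u$2)" using D by simp_all
  then have c: "c = (1 - s - t) *\<^sub>R u + s *\<^sub>R a + t *\<^sub>R b"
    by (simp add: vec2_eq_iff algebra_simps)
  have "orient a b c = (1 - s - t) * orient a b u"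
    unfolding c by (simp add: orient_def algebra_simps)
  then have ne: "s + t \<noteq> 1" using assms(4) by auto
  show ?thesis
  proof (cases "s + t < 1")
    case True
    then have "in_triangle u a b c"
      unfolding in_triangle_def using st c by (intro exI[of _ "1 - s - t"] exI[of _ s] exI[of _ t]) auto
    then show ?thesis ..
  next
    case False
    then have gt: "s + t > 1" using ne by simp
    \<comment> \<open>The point \<open>u + (c - u) / (s + t)\<close>, where the two segments
      meet.\<close>
    define z where "z = (1 - t / (s + t)) *\<^sub>R a + (t / (s + t)) *\<^sub>R b"
    have "a \<noteq> b" using assms(3) by auto
    moreover have "0 < t / (s + t)" "t / (s + t) < 1" using st by (simp_all add: field_simps)
    ultimately have 1: "z \<in> open_segment a b" unfolding in_segment z_def by blast
    have "c - u = s *\<^sub>R (a - u) + t *\<^sub>R (b - u)" by (simp add: c algebra_simps)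
    then have "(1 / (s + t)) *\<^sub>R (c - u) = (s / (s + t)) *\<^sub>R (a - u) + (t / (s + t)) *\<^sub>R (b - u)"
      by (simp add: scaleR_add_right)
    moreover have "s / (s + t) = 1 - t / (s + t)" using gt by (simp add: field_simps)
    ultimately have "z = (1 - 1 / (s + t)) *\<^sub>R u + (1 / (s + t)) *\<^sub>R c"
      by (simp add: z_def algebra_simps)
    moreover have "u \<noteq> c" using assms(1) by auto
    moreover have "0 < 1 / (s + t)" "1 / (s + t) < 1" using gt by simp_all
    ultimately have "z \<in> open_segment u c" unfolding in_segment by blast
    with 1 show ?thesis by blast
  qed
qed

text \<open>
  The segment leaves through the side opposite to the vertex for which the quotient of the
  barycentric coordinates of its two ends is smallest.
\<close>

lemma segment_exits_side:
  fixes a b c v w :: "real ^ 2"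
  assumes "v = l1 *\<^sub>R a + l2 *\<^sub>R b + l3 *\<^sub>R c" "w = m1 *\<^sub>R a + m2 *\<^sub>R b + m3 *\<^sub>R c"
    and "l1 + l2 + l3 = 1" "m1 + m2 + m3 = 1" "l3 > 0" "m3 < 0"
    and "l3 * m1 > l1 * m3" "l3 * m2 > l2 * m3" "v \<noteq> w" "a \<noteq> b"
  shows "open_segment v w \<inter> open_segment a b \<noteq> {}"
proof -
  \<comment> \<open>At parameter \<open>t\<close> between \<open>v\<close> and \<open>w\<close> the
    coordinate belonging to \<open>c\<close> vanishes; the other two are then \<open>n1\<close> and
    \<open>n2\<close>.\<close>
  define t where "t = l3 / (l3 - m3)"
  have d: "l3 - m3 > 0" using assms by simp
  have t: "0 < t" "t < 1" using assms by (simp_all add: t_def field_simps)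
  define n1 where "n1 = (1 - t) * l1 + t * m1"
  define n2 where "n2 = (1 - t) * l2 + t * m2"
  have t': "1 - t = - m3 / (l3 - m3)" using d by (simp add: t_def field_simps)
  have "n1 = (l3 * m1 - l1 * m3) / (l3 - m3)" "n2 = (l3 * m2 - l2 * m3) / (l3 - m3)"
    unfolding n1_def n2_def t' unfolding t_def by (simp_all add: diff_divide_distrib mult.commute)
  then have n: "n1 > 0" "n2 > 0" using assms d by simp_all
  have z3: "(1 - t) * l3 + t * m3 = 0" using d by (simp add: t_def field_simps)
  have "n1 + n2 = (1 - t) * (l1 + l2 + l3) + t * (m1 + m2 + m3) - ((1 - t) * l3 + t * m3)"
    by (simp add: n1_def n2_def algebra_simps)
  then have sum: "n1 = 1 - n2" using z3 assms(3,4) by simp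
  define z where "z = (1 - t) *\<^sub>R v + t *\<^sub>R w"
  have "z = n1 *\<^sub>R a + n2 *\<^sub>R b + ((1 - t) * l3 + t * m3) *\<^sub>R c"
    unfolding z_def assms(1,2) n1_def n2_def by (simp add: algebra_simps)
  then have "z = (1 - n2) *\<^sub>R a + n2 *\<^sub>R b" by (simp add: z3 sum)
  moreover have "n2 < 1" using n(1) sum by simp
  ultimately have "z \<in> open_segment a b" using n(2) assms unfolding in_segment by blast
  moreover have "z \<in> open_segment v w" using t assms z_def unfolding in_segment by blast
  ultimately show ?thesis by blast
qed

text \<open>If \<open>w\<close> had a negative barycentric coordinate, the smallest of the quotients
  \<open>q1\<close>, \<open>q2\<close>, \<open>q3\<close> would be negative, and the segment would
  cross the corresponding side. The nonvanishing orientations exclude ties and zero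
  coordinates.\<close>

lemma segment_exits_triangle:
  assumes v: "in_triangle a b c v"
    and ne: "orient a b c \<noteq> 0" "orient v w a \<noteq> 0" "orient v w b \<noteq> 0" "orient v w c \<noteq> 0"
      "orient a b w \<noteq> 0" "orient b c w \<noteq> 0" "orient c a w \<noteq> 0"
    and disj: "open_segment v w \<inter> open_segment a b = {}" "open_segment v w \<inter> open_segment b c = {}"
      "open_segment v w \<inter> open_segment c a = {}"
  shows "in_triangle a b c w"
proof -
  obtain l1 l2 l3 where l: "l1 > 0" "l2 > 0" "l3 > 0" "l1 + l2 + l3 = 1" "v = l1 *\<^sub>R a + l2 *\<^sub>R b + l3 *\<^sub>R c"
    using v by (auto simp: in_triangle_def)
  define D where "D = orient a b c"
  \<comment> \<open>Barycentric coordinates of \<open>w\<close> as quotients of signed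
    areas.\<close>
  define m1 where "m1 = orient b c w / D"
  define m2 where "m2 = orient c a w / D"
  define m3 where "m3 = orient a b w / D"
  have D: "D \<noteq> 0" using ne D_def by simp
  have Dm: "D * m1 = orient b c w" "D * m2 = orient c a w" "D * m3 = orient a b w"
    using D by (simp_all add: m1_def m2_def m3_def)
  have "D * (m1 + m2 + m3) = D * 1"
    unfolding distrib_left Dm by (simp add: D_def orient_def algebra_simps)
  then have m: "m1 + m2 + m3 = 1" using D by simp
  have "D * w$1 = D * m1 * a$1 + D * m2 * b$1 + D * m3 * c$1"
       "D * w$2 = D * m1 * a$2 + D * m2 * b$2 + D * m3 * c$2"
    unfolding Dm by (simp_all add: D_def orient_def algebra_simps)
  then have "D * w$1 = D * (m1 * a$1 + m2 * b$1 + m3 * c$1)"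
       "D * w$2 = D * (m1 * a$2 + m2 * b$2 + m3 * c$2)" by (simp_all add: algebra_simps)
  then have w: "w = m1 *\<^sub>R a + m2 *\<^sub>R b + m3 *\<^sub>R c" using D by (simp add: vec2_eq_iff)
  have mne: "m1 \<noteq> 0" "m2 \<noteq> 0" "m3 \<noteq> 0" using ne D by (simp_all add: m1_def m2_def m3_def)
  have l3: "l3 = 1 - l1 - l2" and m3: "m3 = 1 - m1 - m2" using l m by simp_all
  have "orient v w c = (l1 * m2 - l2 * m1) * D" "orient v w a = (l2 * m3 - l3 * m2) * D" "orient v w b = (l3 * m1 - l1 * m3) * D"
    unfolding l(5) w D_def l3 m3 by (simp_all add: orient_def algebra_simps)
  then have q: "l1 * m2 \<noteq> l2 * m1" "l2 * m3 \<noteq> l3 * m2" "l3 * m1 \<noteq> l1 * m3" using ne by auto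
  have vw: "v \<noteq> w" and abc: "a \<noteq> b" "b \<noteq> c" "c \<noteq> a" using ne by auto
  define q1 where "q1 = m1 / l1"
  define q2 where "q2 = m2 / l2"
  define q3 where "q3 = m3 / l3"
  have qlt: "q1 < q2 \<longleftrightarrow> l2 * m1 < l1 * m2" "q2 < q1 \<longleftrightarrow> l2 * m1 > l1 * m2"
     "q2 < q3 \<longleftrightarrow> l3 * m2 < l2 * m3" "q3 < q2 \<longleftrightarrow> l3 * m2 > l2 * m3"
     "q3 < q1 \<longleftrightarrow> l1 * m3 < l3 * m1" "q1 < q3 \<longleftrightarrow> l1 * m3 > l3 * m1"
    using l by (auto simp: q1_def q2_def q3_def field_simps)
  have qneg: "q1 < 0 \<longleftrightarrow> m1 < 0" "q2 < 0 \<longleftrightarrow> m2 < 0" "q3 < 0 \<longleftrightarrow> m3 < 0"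
    using l by (auto simp: q1_def q2_def q3_def field_simps)
  have "\<not> (m3 < 0 \<and> q3 < q1 \<and> q3 < q2)"
    using segment_exits_side[of v l1 a l2 b l3 c w m1 m2 m3] l w m qlt vw abc disj(1) by auto
  moreover have "\<not> (m1 < 0 \<and> q1 < q2 \<and> q1 < q3)"
    using segment_exits_side[of v l2 b l3 c l1 a w m2 m3 m1] l w m qlt vw abc disj(2)
    by (auto simp: algebra_simps)
  moreover have "\<not> (m2 < 0 \<and> q2 < q3 \<and> q2 < q1)"
    using segment_exits_side[of v l3 c l1 a l2 b w m3 m1 m2] l w m qlt vw abc disj(3)
    by (auto simp: algebra_simps)
  moreover have "q1 \<noteq> q2" "q2 \<noteq> q3" "q3 \<noteq> q1" using q l by (auto simp: q1_def q2_def q3_def field_simps)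
  ultimately have "m1 > 0" "m2 > 0" "m3 > 0" using mne qneg by linarith+
  then show ?thesis unfolding in_triangle_def using w m by blast
qed

subsection \<open>Uncrossed edges of complete geometric graphs\<close>

text \<open>Only edges within \<open>S\<close> count, so passing to a subset may turn a crossed edge
  into an uncrossed one.\<close>

definition uncrossed :: "('a \<Rightarrow> real ^ 2) \<Rightarrow> 'a set \<Rightarrow> 'a set set" where
  "uncrossed p S =
     {e \<in> pairs S. \<forall>f\<in>pairs S. f \<noteq> e \<longrightarrow> edge_interior p e \<inter> edge_interior p f = {}}"

lemma uncrossedD:
  assumes "{u, v} \<in> uncrossed p S" "a \<in> S" "b \<in> S" "a \<noteq> b" "{a, b} \<noteq> {u, v}"
  shows "open_segment (p u) (p v) \<inter> open_segment (p a) (p b) = {}"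
proof -
  have "{a, b} \<in> pairs S" using assms by simp
  moreover have "\<forall>f\<in>pairs S. f \<noteq> {u, v} \<longrightarrow> edge_interior p {u, v} \<inter> edge_interior p f = {}"
    using assms(1) unfolding uncrossed_def mem_Collect_eq by (rule conjunct2)
  ultimately have "edge_interior p {u, v} \<inter> edge_interior p {a, b} = {}"
    using assms(5) by metis
  then show ?thesis unfolding edge_interior_pair .
qed

definition right_nbrs :: "('a \<Rightarrow> real ^ 2) \<Rightarrow> 'a set \<Rightarrow> 'a \<Rightarrow> 'a set" where
  "right_nbrs p S u = {v \<in> S. lex_less (p u) (p v) \<and> {u, v} \<in> uncrossed p S}"

text \<open>Keeps just what the charging argument uses: a triangle with \<open>u\<close> as its
  lexicographically first corner and \<open>v\<close> inside.\<close>

definition middle_nbrs :: "('a \<Rightarrow> real ^ 2) \<Rightarrow> 'a set \<Rightarrow> 'a \<Rightarrow> 'a set" where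
  "middle_nbrs p S u = {v \<in> right_nbrs p S u. \<exists>a\<in>S. \<exists>b\<in>S. u \<noteq> a \<and> u \<noteq> b \<and> a \<noteq> b \<and> v \<noteq> a \<and> v \<noteq> b \<and>
     lex_less (p u) (p a) \<and> lex_less (p u) (p b) \<and> in_triangle (p u) (p a) (p b) (p v)}"

lemma middle_nbrs_right: "middle_nbrs p S u \<subseteq> right_nbrs p S u"
  by (auto simp: middle_nbrs_def)

lemma right_nbr_neq: "v \<in> right_nbrs p S u \<Longrightarrow> u \<noteq> v"
  by (auto simp: right_nbrs_def lex_less_def)

lemma middle_if_between:
  assumes gp: "general_position S p" and u: "u \<in> S"
    and abc: "a \<in> right_nbrs p S u" "b \<in> right_nbrs p S u" "c \<in> right_nbrs p S u"
    and o: "orient (p u) (p a) (p c) > 0" "orient (p u) (p c) (p b) > 0" "orient (p u) (p a) (p b) > 0"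
  shows "c \<in> middle_nbrs p S u"
proof -
  have S: "a \<in> S" "b \<in> S" "c \<in> S" "lex_less (p u) (p a)" "lex_less (p u) (p b)" "{u, c} \<in> uncrossed p S"
    using abc by (auto simp: right_nbrs_def)
  have u3: "u \<noteq> a" "u \<noteq> b" "u \<noteq> c" using abc right_nbr_neq by metis+
  have d: "a \<noteq> b" "a \<noteq> c" "b \<noteq> c" using o by auto
  have "orient (p a) (p b) (p c) \<noteq> 0" by (rule general_positionD[OF gp]; use S d in simp)
  moreover have "open_segment (p u) (p c) \<inter> open_segment (p a) (p b) = {}"
    using S d u3 by (intro uncrossedD[of u c p S a b]) (auto simp: doubleton_eq_iff)
  ultimately have "in_triangle (p u) (p a) (p b) (p c)"
    using between_in_triangle_or_crosses[of "p u" "p a" "p c" "p b"] o by blast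
  then show ?thesis unfolding middle_nbrs_def using S u3 d abc(3) by auto
qed

text \<open>By \<open>no_cyclic_turn\<close> the right neighbours are linearly ordered by angle
  around \<open>u\<close>; the middle one of the three qualifies.\<close>

lemma middle_of_three:
  assumes gp: "general_position S p" and u: "u \<in> S"
    and abc: "a \<in> right_nbrs p S u" "b \<in> right_nbrs p S u" "c \<in> right_nbrs p S u"
    and d: "a \<noteq> b" "a \<noteq> c" "b \<noteq> c"
  shows "a \<in> middle_nbrs p S u \<or> b \<in> middle_nbrs p S u \<or> c \<in> middle_nbrs p S u"
proof -
  let ?o = "\<lambda>x y. orient (p u) (p x) (p y)" and ?M = "middle_nbrs p S u"
  have S: "a \<in> S" "b \<in> S" "c \<in> S" and l: "lex_less (p u) (p a)" "lex_less (p u) (p b)" "lex_less (p u) (p c)"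
    using abc by (auto simp: right_nbrs_def)
  have u3: "u \<noteq> a" "u \<noteq> b" "u \<noteq> c" using abc right_nbr_neq by metis+
  have "?o a b \<noteq> 0" "?o b c \<noteq> 0" "?o a c \<noteq> 0"
    by (rule general_positionD[OF gp u]; use S u3 d in simp)+
  moreover have sw: "?o b a = - ?o a b" "?o c b = - ?o b c" "?o c a = - ?o a c"
    by (rule orient_swap(2))+
  ultimately have s: "?o a b > 0 \<or> ?o b a > 0" "?o b c > 0 \<or> ?o c b > 0" "?o a c > 0 \<or> ?o c a > 0"
    by linarith+
  have mid: "z \<in> ?M" if xyz: "x \<in> right_nbrs p S u" "z \<in> right_nbrs p S u" "y \<in> right_nbrs p S u"
    and o: "?o x z > 0" "?o z y > 0" for x y z
  proof -
    have "?o x y > 0" using no_cyclic_turn[OF _ _ _ o] xyz by (simp add: right_nbrs_def)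
    then show ?thesis using middle_if_between[OF gp u xyz(1,3,2) o] by blast
  qed
  have "b \<in> ?M" if "?o a b > 0" "?o b c > 0" using mid[OF abc(1,2,3) that] .
  moreover have "c \<in> ?M" if "?o a c > 0" "?o c b > 0" using mid[OF abc(1,3,2) that] .
  moreover have "a \<in> ?M" if "?o b a > 0" "?o a c > 0" using mid[OF abc(2,1,3) that] .
  moreover have "c \<in> ?M" if "?o b c > 0" "?o c a > 0" using mid[OF abc(2,3,1) that] .
  moreover have "a \<in> ?M" if "?o c a > 0" "?o a b > 0" using mid[OF abc(3,1,2) that] .
  moreover have "b \<in> ?M" if "?o c b > 0" "?o b a > 0" using mid[OF abc(3,2,1) that] .
  ultimately show ?thesis using s by argo
qed

lemma card_not_middle:
  assumes gp: "general_position S p" and u: "u \<in> S" and fin: "finite S"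
  shows "card (right_nbrs p S u - middle_nbrs p S u) \<le> 2"
proof (rule ccontr)
  let ?A = "right_nbrs p S u - middle_nbrs p S u"
  assume "\<not> card ?A \<le> 2"
  then have "3 \<le> card ?A" by simp
  then obtain T where "T \<subseteq> ?A" "card T = 3" using obtain_subset_with_card_n by metis
  then obtain a b c where "a \<in> ?A" "b \<in> ?A" "c \<in> ?A" "a \<noteq> b" "a \<noteq> c" "b \<noteq> c"
    by (auto simp: card_3_iff)
  then show False using middle_of_three[OF gp u, of a b c] by blast
qed

text \<open>The edge \<open>{v, w}\<close> starts at \<open>v\<close> inside the triangle of
  \<open>u\<close>, \<open>a\<close>, \<open>b\<close> and crosses no side, so \<open>w\<close> is
  inside too or is a corner other than \<open>u\<close>. All these points come after
  \<open>u\<close>.\<close>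

lemma left_of_middle:
  assumes gp: "general_position S p" and S: "u \<in> S" "w \<in> S" and ne: "w \<noteq> u"
    and v: "v \<in> middle_nbrs p S u" and w: "v \<in> right_nbrs p S w"
  shows "lex_less (p u) (p w)"
proof -
  obtain a b where ab: "a \<in> S" "b \<in> S" "u \<noteq> a" "u \<noteq> b" "a \<noteq> b" "v \<noteq> a" "v \<noteq> b" "lex_less (p u) (p a)" "lex_less (p u) (p b)"
    "in_triangle (p u) (p a) (p b) (p v)"
    using v unfolding middle_nbrs_def by blast
  show ?thesis
  proof (cases "w = a \<or> w = b")
    case True
    then show ?thesis using ab by blast
  next
    case False
    have vS: "v \<in> S" "{v, w} \<in> uncrossed p S" using w by (auto simp: right_nbrs_def insert_commute)
    have vw: "w \<noteq> v" "u \<noteq> v" using w v right_nbr_neq middle_nbrs_right by (metis, metis subsetD)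
    have "in_triangle (p u) (p a) (p b) (p w)"
    proof (rule segment_exits_triangle[OF ab(10)])
      show "orient (p u) (p a) (p b) \<noteq> 0" "orient (p v) (p w) (p u) \<noteq> 0" "orient (p v) (p w) (p a) \<noteq> 0"
        "orient (p v) (p w) (p b) \<noteq> 0" "orient (p u) (p a) (p w) \<noteq> 0" "orient (p a) (p b) (p w) \<noteq> 0" "orient (p b) (p u) (p w) \<noteq> 0"
        by (rule general_positionD[OF gp]; use ab S vS vw ne False in auto)+
      show "open_segment (p v) (p w) \<inter> open_segment (p u) (p a) = {}"
        "open_segment (p v) (p w) \<inter> open_segment (p a) (p b) = {}"
        "open_segment (p v) (p w) \<inter> open_segment (p b) (p u) = {}"
        by (rule uncrossedD[OF vS(2)]; use ab S vS vw ne False in \<open>auto simp: doubleton_eq_iff\<close>)+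
    qed
    then show ?thesis using lex_less_in_triangle ab by blast
  qed
qed

text \<open>An uncrossed edge is charged to its lexicographically smaller endpoint if the other end
  is not a middle neighbour, at most twice per vertex, and otherwise to its larger endpoint, at most
  once: two vertices with a common middle neighbour would each precede the other.\<close>

lemma card_uncrossed:
  assumes gp: "general_position S p" and inj: "inj_on p S" and fin: "finite S"
  shows "card (uncrossed p S) \<le> 3 * card S"
proof -
  let ?R = "right_nbrs p S" and ?M = "middle_nbrs p S"
  have finR: "finite (?R u)" "finite (?M u)" for u
    using fin by (auto simp: middle_nbrs_def right_nbrs_def)
  have "uncrossed p S \<subseteq> (\<lambda>(u, v). {u, v}) ` Sigma S ?R"
  proof
    fix e assume e: "e \<in> uncrossed p S"
    then obtain u v where uv: "e = {u, v}" "u \<noteq> v" "u \<in> S" "v \<in> S"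
      unfolding uncrossed_def by (auto elim: pairsE)
    have "p u \<noteq> p v" using inj uv by (auto dest: inj_onD)
    then consider "lex_less (p u) (p v)" | "lex_less (p v) (p u)" using lex_less_linear by blast
    then show "e \<in> (\<lambda>(u, v). {u, v}) ` Sigma S ?R"
    proof cases
      case 1
      then have "(u, v) \<in> Sigma S ?R" using uv e by (auto simp: right_nbrs_def)
      then show ?thesis using uv(1) by force
    next
      case 2
      then have "(v, u) \<in> Sigma S ?R" using uv e by (auto simp: right_nbrs_def insert_commute)
      then show ?thesis using uv(1) by (force simp: insert_commute)
    qed
  qed
  then have "card (uncrossed p S) \<le> card (Sigma S ?R)"
    using fin finR by (intro surj_card_le) auto
  also have "Sigma S ?R = Sigma S (\<lambda>u. ?R u - ?M u) \<union> Sigma S ?M"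
    using middle_nbrs_right by fast
  also have "card \<dots> \<le> card (Sigma S (\<lambda>u. ?R u - ?M u)) + card (Sigma S ?M)"
    by (rule card_Un_le)
  also have "card (Sigma S (\<lambda>u. ?R u - ?M u)) = (\<Sum>u\<in>S. card (?R u - ?M u))"
    using fin finR by (intro card_SigmaI) auto
  also have "\<dots> \<le> (\<Sum>u\<in>S. 2)"
    using card_not_middle[OF gp _ fin] by (intro sum_mono)
  also have "card (Sigma S ?M) \<le> card S"
  proof (rule card_inj_on_le[of snd])
    show "inj_on snd (Sigma S ?M)"
    proof (rule inj_onI)
      fix x y assume xy: "x \<in> Sigma S ?M" "y \<in> Sigma S ?M" "snd x = snd y"
      then obtain u w v where uwv: "x = (u, v)" "y = (w, v)" "u \<in> S" "w \<in> S" "v \<in> ?M u" "v \<in> ?M w"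
        by auto
      have "u = w"
      proof (rule ccontr)
        assume "u \<noteq> w"
        then have "lex_less (p u) (p w)" "lex_less (p w) (p u)"
          using left_of_middle[OF gp, of u w v] left_of_middle[OF gp, of w u v] uwv middle_nbrs_right[of p S]
          by blast+
        then show False using lex_less_asym by blast
      qed
      then show "x = y" using uwv by simp
    qed
    show "snd ` Sigma S ?M \<subseteq> S" by (auto simp: middle_nbrs_def right_nbrs_def)
  qed (use fin in auto)
  finally show ?thesis by simp
qed

subsection \<open>Random sampling\<close>

text \<open>Probability of obtaining \<open>S\<close> when each vertex of \<open>V\<close> is kept
  independently with probability \<open>q\<close>; weighted sums over \<open>Pow V\<close> are
  expectations.\<close>

definition sample_weight :: "real \<Rightarrow> 'a set \<Rightarrow> 'a set \<Rightarrow> real" where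
  "sample_weight q V S = q ^ card S * (1 - q) ^ card (V - S)"

lemma sum_sample_weight_superset:
  assumes "finite V" "A \<subseteq> V"
  shows "(\<Sum>S\<in>Pow V. sample_weight q V S * of_bool (A \<subseteq> S)) = q ^ card A"
proof -
  \<comment> \<open>The factor 0 for omitting a vertex of \<open>A\<close> absorbs the condition
    \<open>A \<subseteq> S\<close>, so that the sum is an expanded product.\<close>
  let ?g = "\<lambda>x. if x \<in> A then 0 else 1 - q"
  have "(\<Sum>S\<in>Pow V. sample_weight q V S * of_bool (A \<subseteq> S)) = (\<Sum>S\<in>Pow V. (\<Prod>x\<in>S. q) * (\<Prod>x\<in>V-S. ?g x))"
  proof (rule sum.cong[OF refl])
    fix S assume "S \<in> Pow V"
    then have S: "S \<subseteq> V" "finite (V - S)" using assms by (auto intro: finite_subset)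
    show "sample_weight q V S * of_bool (A \<subseteq> S) = (\<Prod>x\<in>S. q) * (\<Prod>x\<in>V-S. ?g x)"
    proof (cases "A \<subseteq> S")
      case True
      then have "(\<Prod>x\<in>V-S. ?g x) = (\<Prod>x\<in>V-S. 1 - q)" by (intro prod.cong) auto
      then show ?thesis using True by (simp add: sample_weight_def)
    next
      case False
      then obtain x where "x \<in> V - S" "x \<in> A" using assms by blast
      then have "(\<Prod>x\<in>V-S. ?g x) = 0" using S(2) by (intro prod_zero) auto
      then show ?thesis using False by simp
    qed
  qed
  also have "\<dots> = (\<Prod>x\<in>V. q + ?g x)" using assms by (simp add: prod_add)
  also have "\<dots> = (\<Prod>x\<in>A. q) * (\<Prod>x\<in>V-A. 1)"
    using assms by (subst prod.subset_diff[OF assms(2,1)]) (auto intro!: prod.cong)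
  finally show ?thesis by simp
qed

lemma sum_sample_weight_card:
  assumes "finite V"
  shows "(\<Sum>S\<in>Pow V. sample_weight q V S * card S) = q * card V"
proof -
  have "(\<Sum>S\<in>Pow V. sample_weight q V S * card S) = (\<Sum>S\<in>Pow V. \<Sum>v\<in>V. sample_weight q V S * of_bool ({v} \<subseteq> S))"
  proof (rule sum.cong[OF refl])
    fix S assume "S \<in> Pow V"
    then have "(\<Sum>v\<in>V. of_bool ({v} \<subseteq> S)) = real (card S)"
      using assms by (simp add: of_bool_def sum.If_cases Int_absorb1)
    then show "sample_weight q V S * card S = (\<Sum>v\<in>V. sample_weight q V S * of_bool ({v} \<subseteq> S))"
      by (simp add: sum_distrib_left[symmetric])
  qed
  also have "\<dots> = (\<Sum>v\<in>V. q)"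
    using sum_sample_weight_superset[OF assms, of "{v}" q for v]
    by (subst sum.swap) simp
  finally show ?thesis by simp
qed

section \<open>Crossing edges versus crossing points\<close>

definition crossing_edges :: "'a set \<Rightarrow> ('a \<Rightarrow> real ^ 2) \<Rightarrow> 'a set \<Rightarrow> 'a set set" where
  "crossing_edges V p e = {f \<in> pairs V. f \<noteq> e \<and> edge_interior p e \<inter> edge_interior p f \<noteq> {}}"

lemma finite_crossing_edges [simp]: "finite V \<Longrightarrow> finite (crossing_edges V p e)"
  by (simp add: crossing_edges_def)

lemma crossings_on_eq:
  "crossings_on (pairs V) p e = (\<Union>f\<in>crossing_edges V p e. edge_interior p e \<inter> edge_interior p f)"
  by (auto simp: crossings_on_def crossing_edges_def)

lemma single_crossing:
  assumes "general_position V p" "e \<in> pairs V" "f \<in> crossing_edges V p e"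
  shows "\<exists>x. edge_interior p e \<inter> edge_interior p f = {x}"
proof -
  obtain x where x: "x \<in> edge_interior p e \<inter> edge_interior p f"
    using assms(3) by (auto simp: crossing_edges_def)
  have "y = x" if "y \<in> edge_interior p e \<inter> edge_interior p f" for y
    using edges_meet_once[OF assms(1,2), of f y x] that x assms(3) by (auto simp: crossing_edges_def)
  then show ?thesis using x by blast
qed

lemma finite_crossings_on:
  assumes "general_position V p" "e \<in> pairs V" "finite V"
  shows "finite (crossings_on (pairs V) p e)"
  unfolding crossings_on_eq using single_crossing[OF assms(1,2)] assms(3)
  by (metis (no_types, lifting) finite.emptyI finite.insertI finite_UN_I finite_crossing_edges)

lemma card_crossings_on_le:
  assumes "general_position V p" "e \<in> pairs V" "finite V"
  shows "card (crossings_on (pairs V) p e) \<le> card (crossing_edges V p e)"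
proof -
  have "card (crossings_on (pairs V) p e) \<le> (\<Sum>f\<in>crossing_edges V p e. card (edge_interior p e \<inter> edge_interior p f))"
    unfolding crossings_on_eq by (rule card_UN_le) (simp add: assms)
  also have "\<dots> = (\<Sum>f\<in>crossing_edges V p e. 1)"
    using single_crossing[OF assms(1,2)] by (intro sum.cong) force+
  finally show ?thesis by simp
qed

text \<open>Sending an edge that crosses \<open>e\<close> to its crossing point is injective because
  no three edges are concurrent. With \<open>card_crossings_on_le\<close>, both ways of counting
  agree.\<close>

lemma card_crossing_edges_le:
  assumes "rectilinear_drawing V (pairs V) p" "e \<in> pairs V" "finite V"
  shows "card (crossing_edges V p e) \<le> card (crossings_on (pairs V) p e)"
proof -
  have gp: "general_position V p" using assms(1) by (simp add: rectilinear_drawing_iff)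
  obtain x where x: "\<And>f. f \<in> crossing_edges V p e \<Longrightarrow> edge_interior p e \<inter> edge_interior p f = {x f}"
    using single_crossing[OF gp assms(2)] by metis
  show ?thesis
  proof (rule card_inj_on_le[of x])
    show "inj_on x (crossing_edges V p e)"
    proof (rule inj_onI, rule ccontr)
      fix f g assume fg: "f \<in> crossing_edges V p e" "g \<in> crossing_edges V p e" "x f = x g" "f \<noteq> g"
      then have "x f \<in> edge_interior p e \<inter> edge_interior p f \<inter> edge_interior p g"
        using x[of f] x[of g] by blast
      moreover have "f \<in> pairs V" "g \<in> pairs V" "e \<noteq> f" "e \<noteq> g"
        using fg by (auto simp: crossing_edges_def)
      ultimately show False using assms(1,2) fg(4) unfolding rectilinear_drawing_iff by blast
    qed
    show "x ` crossing_edges V p e \<subseteq> crossings_on (pairs V) p e"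
      unfolding crossings_on_eq using x by blast
    show "finite (crossings_on (pairs V) p e)" using finite_crossings_on[OF gp] assms by blast
  qed
qed

text \<open>Union bound: \<open>e\<close> is sampled with probability \<open>q ^ 2\<close>, and
  together with a given crossing edge with probability \<open>q ^ 4\<close>, since the two edges
  have four distinct endpoints.\<close>

lemma sample_uncrossed_ge:
  assumes gp: "general_position V p" and fin: "finite V" and e: "e \<in> pairs V"
    and k: "card (crossing_edges V p e) \<le> k" and q: "0 \<le> q" "q \<le> 1"
  shows "(\<Sum>S\<in>Pow V. sample_weight q V S * of_bool (e \<in> uncrossed p S)) \<ge> q ^ 2 - k * q ^ 4"
proof -
  let ?X = "crossing_edges V p e"
  have nonneg: "sample_weight q V S \<ge> 0" for S :: "'a set"
    using q by (simp add: sample_weight_def)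
  have ec: "card e = 2" "e \<subseteq> V" using e by (auto simp: pairs_def)
  have fc: "card (e \<union> f) = 4" "e \<union> f \<subseteq> V" if "f \<in> ?X" for f
  proof -
    have f: "f \<in> pairs V" "f \<noteq> e" "edge_interior p e \<inter> edge_interior p f \<noteq> {}"
      using that by (auto simp: crossing_edges_def)
    then have "e \<inter> f = {}" using crossing_edges_disjoint[OF gp e] by metis
    moreover have "card f = 2" "f \<subseteq> V" using f by (auto simp: pairs_def)
    ultimately show "card (e \<union> f) = 4" "e \<union> f \<subseteq> V"
      using ec fin by (auto simp: card_Un_disjoint finite_subset)
  qed
  have "q ^ 2 - k * q ^ 4 \<le> q ^ 2 - card ?X * q ^ 4"
    using k q by (simp add: mult_right_mono)
  also have "\<dots> = q ^ card e - (\<Sum>f\<in>?X. q ^ card (e \<union> f))"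
    using fc ec by simp
  also have "\<dots> = (\<Sum>S\<in>Pow V. sample_weight q V S * of_bool (e \<subseteq> S)) -
      (\<Sum>f\<in>?X. \<Sum>S\<in>Pow V. sample_weight q V S * of_bool (e \<union> f \<subseteq> S))"
    using sum_sample_weight_superset[OF fin ec(2)] sum_sample_weight_superset[OF fin fc(2)] by simp
  also have "\<dots> = (\<Sum>S\<in>Pow V. sample_weight q V S * (of_bool (e \<subseteq> S) - (\<Sum>f\<in>?X. of_bool (e \<union> f \<subseteq> S))))"
    by (subst sum.swap) (simp add: sum_subtractf right_diff_distrib sum_distrib_left)
  also have "\<dots> \<le> (\<Sum>S\<in>Pow V. sample_weight q V S * of_bool (e \<in> uncrossed p S))"
  proof (rule sum_mono, rule mult_left_mono[OF _ nonneg])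
    fix S assume S: "S \<in> Pow V"
    \<comment> \<open>If \<open>e\<close> lies in \<open>S\<close> but is crossed there, some
      crossing edge within \<open>S\<close> makes the left side nonpositive.\<close>
    show "of_bool (e \<subseteq> S) - (\<Sum>f\<in>?X. of_bool (e \<union> f \<subseteq> S)) \<le> (of_bool (e \<in> uncrossed p S) :: real)"
    proof (cases "e \<subseteq> S \<and> e \<notin> uncrossed p S")
      case False
      have "0 \<le> (\<Sum>f\<in>?X. of_bool (e \<union> f \<subseteq> S) :: real)" by (simp add: sum_nonneg)
      with False show ?thesis by (auto simp: of_bool_def simp del: Un_subset_iff)
    next
      case True
      then obtain f where "f \<in> pairs S" "f \<noteq> e" "edge_interior p e \<inter> edge_interior p f \<noteq> {}"
        using ec by (auto simp: uncrossed_def pairs_def)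
      then have f: "f \<in> ?X" "e \<union> f \<subseteq> S" using S pairs_mono[of S V] True
        by (auto simp: crossing_edges_def pairs_def)
      then have "of_bool (e \<union> f \<subseteq> S) \<le> (\<Sum>f\<in>?X. of_bool (e \<union> f \<subseteq> S) :: real)"
        using fin by (intro member_le_sum) auto
      then show ?thesis using True f(2) by simp
    qed
  qed
  finally show ?thesis .
qed

text \<open>The expected number of edges of \<open>L\<close> that are uncrossed in the sample is
  estimated from below edge by edge and from above by \<open>card_uncrossed\<close>.\<close>

lemma card_lightly_crossed:
  assumes gp: "general_position V p" and inj: "inj_on p V" and fin: "finite V" and k: "1 \<le> k"
  shows "card {e \<in> pairs V. card (crossing_edges V p e) \<le> k} \<le> 12 * card V * sqrt k"
proof -
  define L where "L = {e \<in> pairs V. card (crossing_edges V p e) \<le> k}"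
  \<comment> \<open>This value maximizes \<open>q ^ 2 - k * q ^ 4\<close>, with maximum
    \<open>1 / (4 * k)\<close>; \<open>1 \<le> k\<close> makes it a probability.\<close>
  define q where "q = 1 / sqrt (2 * k)"
  have finL: "finite L" using fin by (simp add: L_def)
  have q: "0 < q" "q \<le> 1" using k by (simp_all add: q_def)
  have q2: "q ^ 2 = 1 / (2 * k)" by (simp add: q_def power_divide)
  have q4: "q ^ 4 = 1 / (4 * k * k)"
  proof -
    have "q ^ 4 = (q ^ 2) ^ 2" by simp
    then show ?thesis unfolding q2 by (simp add: power_divide power2_eq_square)
  qed
  have "card L * (q ^ 2 - k * q ^ 4) = (\<Sum>e\<in>L. q ^ 2 - k * q ^ 4)" by simp
  also have "\<dots> \<le> (\<Sum>e\<in>L. \<Sum>S\<in>Pow V. sample_weight q V S * of_bool (e \<in> uncrossed p S))"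
    using q by (intro sum_mono sample_uncrossed_ge[OF gp fin]) (auto simp: L_def)
  also have "\<dots> = (\<Sum>S\<in>Pow V. sample_weight q V S * (\<Sum>e\<in>L. of_bool (e \<in> uncrossed p S)))"
    by (subst sum.swap) (simp add: sum_distrib_left)
  also have "\<dots> \<le> (\<Sum>S\<in>Pow V. sample_weight q V S * (3 * card S))"
  proof (intro sum_mono mult_left_mono)
    fix S assume "S \<in> Pow V"
    then have S: "S \<subseteq> V" "finite S" using fin by (auto intro: finite_subset)
    have finU: "finite (uncrossed p S)" using S by (simp add: uncrossed_def)
    have "(\<Sum>e\<in>L. of_bool (e \<in> uncrossed p S)) = real (card (L \<inter> uncrossed p S))"
      using finL by (simp add: of_bool_def sum.If_cases Int_def)
    also have "\<dots> \<le> card (uncrossed p S)" using finU by (simp add: card_mono)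
    also have "\<dots> \<le> 3 * card S"
      using card_uncrossed[OF general_position_subset[OF gp S(1)] inj_on_subset[OF inj S(1)] S(2)]
      by linarith
    finally show "(\<Sum>e\<in>L. of_bool (e \<in> uncrossed p S)) \<le> real (3 * card S)" by simp
  qed (use q in \<open>simp add: sample_weight_def\<close>)
  also have "\<dots> = 3 * (\<Sum>S\<in>Pow V. sample_weight q V S * card S)"
    by (simp add: sum_distrib_left mult_ac)
  also have "\<dots> = 3 * q * card V" by (simp add: sum_sample_weight_card[OF fin])
  finally have "card L * (q ^ 2 - k * q ^ 4) \<le> 3 * q * card V" .
  moreover have "q ^ 2 - k * q ^ 4 = 1 / (4 * k)" unfolding q2 q4 using k by (simp add: field_simps)
  ultimately have "card L \<le> 12 * card V * (k * q)" using k by (simp add: field_simps)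
  also have "k * q \<le> sqrt k"
  proof -
    have "k * q = sqrt k * (sqrt k / sqrt (2 * k))" by (simp add: q_def)
    also have "\<dots> \<le> sqrt k * 1" using k by (intro mult_left_mono) auto
    finally show ?thesis by simp
  qed
  finally show ?thesis by (simp add: L_def mult_left_mono)
qed

subsection \<open>Drawings in generic position\<close>

lemma negligible_line:
  assumes "P \<noteq> Q"
  shows "negligible {x. orient P Q x = 0}"
proof -
  define N :: "real ^ 2" where "N = vector [P$2 - Q$2, Q$1 - P$1]"
  have "N \<noteq> 0" using assms by (auto simp: N_def vec2_eq_iff)
  moreover have "{x. orient P Q x = 0} = {x. N \<bullet> x = N \<bullet> P}"
    by (auto simp: N_def orient_def inner_vec_def sum_2 algebra_simps)
  ultimately show ?thesis using negligible_hyperplane by metis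
qed

text \<open>Finitely many points and lines form a null set, which cannot contain a nonempty open
  set.\<close>

lemma exists_off_lines:
  assumes "open U" "U \<noteq> {}" "finite F"
  shows "\<exists>x\<in>U. x \<notin> F \<and> (\<forall>P\<in>F. \<forall>Q\<in>F. P \<noteq> Q \<longrightarrow> orient P Q x \<noteq> 0)"
proof -
  let ?I = "{(P, Q). P \<in> F \<and> Q \<in> F \<and> P \<noteq> Q}"
  let ?L = "(\<lambda>(P, Q). {x. orient P Q x = 0}) ` ?I"
  have "finite ?I" by (rule finite_subset[of _ "F \<times> F"]) (use assms(3) in auto)
  then have "negligible (\<Union>?L)"
    by (intro negligible_Union) (auto intro: negligible_line)
  then have neg: "negligible (F \<union> \<Union>?L)"
    by (rule negligible_Un[OF negligible_finite[OF assms(3)]])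
  have "\<not> U \<subseteq> F \<union> \<Union>?L"
  proof
    assume "U \<subseteq> F \<union> \<Union>?L"
    then have "negligible U" by (rule negligible_subset[OF neg])
    then show False using open_not_negligible[OF assms(1,2)] by contradiction
  qed
  then obtain x where "x \<in> U" "x \<notin> F" "x \<notin> \<Union>?L" by blast
  then show ?thesis by (intro bexI[of _ x]) auto
qed

text \<open>Points are chosen one after another, each off all lines through two earlier vertices or
  crossings, so that neither a collinear triple nor a triple crossing arises.\<close>

lemma exists_drawing_near:
  fixes U :: "nat \<Rightarrow> (real ^ 2) set"
  assumes "\<And>i. open (U i)" "\<And>i. U i \<noteq> {}"
  shows "\<exists>p. (\<forall>i<n. p i \<in> U i) \<and> rectilinear_drawing {..<n} (pairs {..<n}) p"
proof (induction n)
  case 0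
  show ?case by (auto simp: rectilinear_drawing_iff general_position_def pairs_def)
next
  case (Suc n)
  let ?V = "{..<n}" and ?W = "{..<Suc n}"
  obtain p where pU: "\<forall>i<n. p i \<in> U i" and draw: "rectilinear_drawing ?V (pairs ?V) p"
    using Suc by blast
  have inj: "inj_on p ?V" and gp: "general_position ?V p"
    and triple: "\<And>e f g. \<lbrakk>e \<in> pairs ?V; f \<in> pairs ?V; g \<in> pairs ?V; e \<noteq> f; e \<noteq> g; f \<noteq> g\<rbrakk>
        \<Longrightarrow> edge_interior p e \<inter> edge_interior p f \<inter> edge_interior p g = {}"
    using draw unfolding rectilinear_drawing_iff by blast+
  \<comment> \<open>The crossings are included because a new edge through an old crossing would lie
    on a line through that crossing and an old vertex.\<close>
  define F where "F = p ` ?V \<union> (\<Union>e\<in>pairs ?V. crossings_on (pairs ?V) p e)"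
  have "finite F" using finite_crossings_on[OF gp] by (simp add: F_def)
  then obtain x where x: "x \<in> U n" "x \<notin> F" "\<And>P Q. \<lbrakk>P \<in> F; Q \<in> F; P \<noteq> Q\<rbrakk> \<Longrightarrow> orient P Q x \<noteq> 0"
    using exists_off_lines[OF assms] by metis
  define p' where "p' = p(n := x)"
  have old: "p' i = p i" if "i < n" for i using that by (simp add: p'_def)
  have new: "p' n = x" by (simp add: p'_def)
  have inj': "inj_on p' ?W"
    unfolding lessThan_Suc using inj x(2)
    by (auto simp: p'_def inj_on_def F_def)
  have off: "orient (p i) (p j) x \<noteq> 0" if "i < n" "j < n" "i \<noteq> j" for i j
    using that inj by (intro x(3)) (auto simp: F_def dest: inj_onD)
  have gp': "general_position ?W p'"
    unfolding general_position_def
  proof (intro ballI impI)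
    fix u v w assume uvw: "u \<in> ?W" "v \<in> ?W" "w \<in> ?W" "u \<noteq> v" "u \<noteq> w" "v \<noteq> w"
    consider "u < n" "v < n" "w < n" | "u = n" "v < n" "w < n" | "u < n" "v = n" "w < n" | "u < n" "v < n" "w = n"
      using uvw by fastforce
    then show "orient (p' u) (p' v) (p' w) \<noteq> 0"
    proof cases
      case 1
      then show ?thesis using general_positionD[OF gp, of u v w] uvw by (simp add: old)
    next
      case 2
      then show ?thesis using off[of v w] uvw by (simp add: old new orient_cyclic)
    next
      case 3
      then show ?thesis using off[of w u] uvw orient_cyclic[of x "p w" "p u"] orient_cyclic[of "p w" "p u" x]
        by (simp add: old new)
    next
      case 4
      then show ?thesis using off[of u v] uvw by (simp add: old new)
    qed
  qed
  have old_edge: "edge_interior p' e = edge_interior p e" if "e \<in> pairs ?V" for e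
    using that by (elim pairsE) (simp add: old)
  have split: "e \<in> pairs ?V \<or> n \<in> e" if "e \<in> pairs ?W" for e
    using that by (auto simp: pairs_def less_Suc_eq)
  have new_old: False
    if e: "e \<in> pairs ?W" "n \<in> e" and fg: "f \<in> pairs ?V" "g \<in> pairs ?V" "f \<noteq> g"
      and z: "z \<in> edge_interior p' e" "z \<in> edge_interior p' f" "z \<in> edge_interior p' g" for e f g z
  proof -
    obtain a where a: "e = {n, a}" "a < n"
      using e by (elim pairsE) (auto simp: less_Suc_eq insert_commute)
    have "z \<in> open_segment x (p a)" using z(1) a by (simp add: old new)
    then have "z \<noteq> p a" "orient x (p a) z = 0" by (auto simp: open_segment_def intro: orient_open_segment)
    moreover have "z \<in> crossings_on (pairs ?V) p f"
      using z fg by (auto simp: crossings_on_def old_edge)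
    then have "z \<in> F" using fg by (auto simp: F_def)
    moreover have "p a \<in> F" using a by (simp add: F_def)
    ultimately show False using x(3)[of "p a" z] by (simp add: orient_cyclic)
  qed
  have new_new: False
    if "e \<in> pairs ?W" "f \<in> pairs ?W" "e \<noteq> f" "n \<in> e" "n \<in> f" "z \<in> edge_interior p' e" "z \<in> edge_interior p' f" for e f z
    using crossing_edges_disjoint[OF gp' that(1-3)] that by blast
  have "edge_interior p' e \<inter> edge_interior p' f \<inter> edge_interior p' g = {}"
    if efg: "e \<in> pairs ?W" "f \<in> pairs ?W" "g \<in> pairs ?W" "e \<noteq> f" "e \<noteq> g" "f \<noteq> g" for e f g
  proof (rule ccontr)
    assume "\<not> ?thesis"
    then obtain z where z: "z \<in> edge_interior p' e" "z \<in> edge_interior p' f" "z \<in> edge_interior p' g" by blast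
    consider "n \<in> e" "n \<in> f" | "n \<in> e" "n \<in> g" | "n \<in> f" "n \<in> g"
      | "n \<in> e" "f \<in> pairs ?V" "g \<in> pairs ?V" | "n \<in> f" "e \<in> pairs ?V" "g \<in> pairs ?V"
      | "n \<in> g" "e \<in> pairs ?V" "f \<in> pairs ?V" | "e \<in> pairs ?V" "f \<in> pairs ?V" "g \<in> pairs ?V"
      using split efg by metis
    then show False
    proof cases
      case 7
      then show False using triple[of e f g] efg z by (simp add: old_edge) blast
    qed (use new_new new_old efg z in metis)+
  qed
  then have "rectilinear_drawing ?W (pairs ?W) p'"
    unfolding rectilinear_drawing_iff using inj' gp' by blast
  moreover have "\<forall>i<Suc n. p' i \<in> U i" using pU x(1) by (auto simp: less_Suc_eq old new)
  ultimately show ?case by blast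
qed

subsection \<open>Blocks of opposite orientation\<close>

text \<open>Blocks are the classes of \<open>v div m\<close>. Comparing the outer indices suffices:
  for \<open>a < b < c\<close>, a block that contains \<open>a\<close> and \<open>c\<close> contains
  \<open>b\<close>.\<close>

definition turn_sign :: "nat \<Rightarrow> nat \<Rightarrow> nat \<Rightarrow> real" where
  "turn_sign m a c = (if a div m = c div m then - 1 else 1)"

definition clustered :: "nat \<Rightarrow> nat \<Rightarrow> (nat \<Rightarrow> real ^ 2) \<Rightarrow> bool" where
  "clustered m n p \<longleftrightarrow> (\<forall>a b c. a < b \<longrightarrow> b < c \<longrightarrow> c < n \<longrightarrow>
     turn_sign m a c * orient (p a) (p b) (p c) > 0)"

lemma open_clustered: "open {p. clustered m n p}"
proof -
  let ?I = "{(a, b, c). a < b \<and> b < c \<and> c < n}"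
  have "{p. clustered m n p} =
     (\<Inter>(a, b, c)\<in>?I. {p. 0 < turn_sign m a c * orient (p a) (p b) (p c)})"
    by (auto simp: clustered_def)
  moreover have "?I \<subseteq> {..<n} \<times> {..<n} \<times> {..<n}" by auto
  then have "finite ?I" by (rule finite_subset) simp
  ultimately show ?thesis
    unfolding orient_def
    by (auto intro!: open_INT open_Collect_less continuous_intros continuous_on_component)
qed

text \<open>
  With $d$ as the slopes between consecutive points the double sum is the orientation of three
  points. The slopes decrease by $1$ inside a block and jump up by $n^3$ at its ends.
\<close>

lemma clustered_sum_pos:
  fixes a b c n m :: nat
  defines "d \<equiv> \<lambda>t. real (n ^ 3 + 1) * real (t div m + (t + 1) div m) - real t"
  assumes abc: "a < b" "b < c" "c < n"
  shows "turn_sign m a c * (\<Sum>(s, t)\<in>{a..<b} \<times> {b..<c}. d t - d s) > 0"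
proof -
  let ?J = "{a..<b} \<times> {b..<c}"
  have ac: "(a, c - 1) \<in> ?J" using abc by auto
  have ne: "?J \<noteq> {}" using ac by blast
  show ?thesis
  proof (cases "a div m = c div m")
    case True
    \<comment> \<open>Within a single block the term with the large factor is constant, so only the
      decrease by 1 per step remains.\<close>
    have eq: "t div m = a div m" if "a \<le> t" "t \<le> c" for t
      using div_le_mono[OF that(1), of m] div_le_mono[OF that(2), of m] True by simp
    have "(\<Sum>(s, t)\<in>?J. d t - d s) < 0"
    proof -
      have "(\<Sum>x\<in>?J. case x of (s, t) \<Rightarrow> d t - d s) < (\<Sum>x\<in>?J. 0)"
      proof (rule sum_strict_mono)
        fix x assume "x \<in> ?J"
        then obtain s t where x: "x = (s, t)" "a \<le> s" "s < b" "b \<le> t" "t < c" by auto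
        have "d t - d s = real s - real t"
          unfolding d_def using x eq[of s] eq[of "s + 1"] eq[of t] eq[of "t + 1"] by simp
        then show "(case x of (s, t) \<Rightarrow> d t - d s) < 0" using x by simp
      qed (use ne in auto)
      then show ?thesis by simp
    qed
    then show ?thesis using True by (simp add: turn_sign_def)
  next
    case False
    have "a div m < c div m" using False div_le_mono[of a c m] abc by simp
    moreover have "(a + 1) div m \<le> (c - 1) div m" using abc by (intro div_le_mono) simp
    \<comment> \<open>\<open>d t\<close> involves the blocks of both \<open>t\<close> and
      \<open>t + 1\<close>, so a block boundary anywhere from \<open>a\<close> to \<open>c\<close>
      separates \<open>d a\<close> from \<open>d (c - 1)\<close>, even one right after
      \<open>a\<close> or right before \<open>c\<close>.\<close>
    ultimately have jump: "a div m + (a + 1) div m + 1 \<le> (c - 1) div m + (c - 1 + 1) div m"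
      using abc by simp
    \<comment> \<open>The summand at \<open>(a, c - 1)\<close> gains at least
      \<open>n ^ 3 + 1\<close>; the linear part costs each of the at most \<open>n * n\<close>
      summands at most \<open>n\<close>, hence at most \<open>n ^ 3\<close> in total.\<close>
    have lower: "(if x = (a, c - 1) then real (n ^ 3 + 1) else 0) - real n \<le> (case x of (s, t) \<Rightarrow> d t - d s)" if xJ: "x \<in> ?J" for x
    proof -
      obtain s t where x: "x = (s, t)" "a \<le> s" "s < b" "b \<le> t" "t < c" using xJ by auto
      define j where "j = real (t div m + (t + 1) div m) - real (s div m + (s + 1) div m)"
      have "s div m \<le> t div m" "(s + 1) div m \<le> (t + 1) div m" using x by (auto intro: div_le_mono)
      then have j0: "j \<ge> 0" by (simp add: j_def)
      have j1: "j \<ge> 1" if "x = (a, c - 1)"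
      proof -
        have "s = a" "t = c - 1" using that x(1) by simp_all
        then have "real (s div m + (s + 1) div m + 1) \<le> real (t div m + (t + 1) div m)"
          using jump by (intro of_nat_mono) simp
        then show ?thesis by (simp add: j_def)
      qed
      have "(if x = (a, c - 1) then real (n ^ 3 + 1) else 0) \<le> real (n ^ 3 + 1) * j"
        using mult_left_mono[OF j1, of "real (n ^ 3 + 1)"] j0 by simp
      moreover have "d t - d s = real (n ^ 3 + 1) * j + real s - real t"
        by (simp add: d_def j_def algebra_simps)
      ultimately show ?thesis using x abc by simp
    qed
    have "card ?J \<le> n * n" using abc by (simp add: card_cartesian_product mult_mono)
    then have "real (card ?J) * real n \<le> real (n * n) * real n"
      by (intro mult_right_mono) (auto simp: of_nat_le_iff[symmetric] simp del: of_nat_le_iff of_nat_mult)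
    then have "real (n ^ 3) \<ge> real (card ?J) * real n"
      by (simp add: power3_eq_cube)
    then have "0 < real (n ^ 3 + 1) - real (card ?J) * real n" by simp
    also have "\<dots> = (\<Sum>x\<in>?J. (if x = (a, c - 1) then real (n ^ 3 + 1) else 0) - real n)"
      using ac by (simp add: sum_subtractf sum.delta)
    also have "\<dots> \<le> (\<Sum>(s, t)\<in>?J. d t - d s)"
      by (rule sum_mono[OF lower])
    finally show ?thesis using False by (simp add: turn_sign_def)
  qed
qed

lemma exists_clustered: "\<exists>p. clustered m n p"
proof -
  define d where "d = (\<lambda>t. real (n ^ 3 + 1) * real (t div m + (t + 1) div m) - real t)"
  \<comment> \<open>With the index as first coordinate, \<open>d t\<close> is the slope from point
    \<open>t\<close> to point \<open>t + 1\<close>.\<close>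
  define p :: "nat \<Rightarrow> real ^ 2" where "p = (\<lambda>v. vector [real v, \<Sum>t<v. d t])"
  have "orient (p a) (p b) (p c) = (\<Sum>(s, t)\<in>{a..<b} \<times> {b..<c}. d t - d s)" if "a < b" "b < c" for a b c
  proof -
    have diff: "(\<Sum>t<v. d t) - (\<Sum>t<u. d t) = (\<Sum>t\<in>{u..<v}. d t)" if "u < v" for u v
      using that by (simp add: lessThan_atLeast0 sum_diff_nat_ivl)
    have "orient (p a) (p b) (p c) = (real b - real a) * ((\<Sum>t<c. d t) - (\<Sum>t<b. d t)) - (real c - real b) * ((\<Sum>t<b. d t) - (\<Sum>t<a. d t))"
      by (simp add: orient_def p_def algebra_simps)
    also have "\<dots> = (real b - real a) * (\<Sum>t\<in>{b..<c}. d t) - (real c - real b) * (\<Sum>s\<in>{a..<b}. d s)"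
      using that by (simp only: diff)
    also have "\<dots> = (\<Sum>s\<in>{a..<b}. \<Sum>t\<in>{b..<c}. d t - d s)"
      using that by (simp add: sum_subtractf sum_distrib_left of_nat_diff)
    finally show ?thesis by (simp add: sum.cartesian_product)
  qed
  then have "clustered m n p" unfolding clustered_def using clustered_sum_pos[of _ _ _ n m] by (simp add: d_def)
  then show ?thesis by blast
qed

lemma exists_clustered_drawing:
  "\<exists>p. clustered m n p \<and> rectilinear_drawing {..<n} (pairs {..<n}) p"
proof -
  obtain q where "q \<in> {p. clustered m n p}" using exists_clustered by blast
  \<comment> \<open>A basic open box around \<open>q\<close> on which all prescribed turns persist;
    \<open>exists_drawing_near\<close> then picks generic points in it.\<close>
  then obtain X where X: "q \<in> (\<Pi>\<^sub>E i\<in>UNIV. X i)" "\<And>i. open (X i)" "(\<Pi>\<^sub>E i\<in>UNIV. X i) \<subseteq> {p. clustered m n p}"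
    using product_topology_open_contains_basis[of "\<lambda>_. euclidean" UNIV "{p. clustered m n p}" q] open_clustered
    unfolding open_fun_def by auto
  have "X i \<noteq> {}" for i using X(1) by auto
  then obtain p where p: "\<forall>i<n. p i \<in> X i" "rectilinear_drawing {..<n} (pairs {..<n}) p"
    using exists_drawing_near[of X n] X(2) by blast
  \<comment> \<open>From index \<open>n\<close> on the values of \<open>q\<close> are kept so that
    \<open>p'\<close> lies in the box; \<open>clustered\<close> looks only at indices below
    \<open>n\<close>.\<close>
  define p' where "p' = (\<lambda>i. if i < n then p i else q i)"
  have "p' \<in> (\<Pi>\<^sub>E i\<in>UNIV. X i)" using p(1) X(1) by (auto simp: p'_def)
  then have "clustered m n p'" using X(3) by blast
  then have "clustered m n p" by (simp add: clustered_def p'_def)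
  then show ?thesis using p(2) by blast
qed

text \<open>If \<open>f\<close> has an endpoint outside the block of \<open>e\<close>, the
  prescribed turns put both endpoints of one of the two edges strictly on the same side of the
  other.\<close>

lemma clustered_crossing:
  assumes cl: "clustered m n p" and gp: "general_position {..<n} p"
    and e: "e \<in> pairs {..<n}" "\<forall>v\<in>e. v div m = i" and f: "f \<in> crossing_edges {..<n} p e"
  shows "\<forall>v\<in>f. v div m = i"
proof (rule ccontr)
  assume contra: "\<not> ?thesis"
  have f': "f \<in> pairs {..<n}" "f \<noteq> e" "edge_interior p e \<inter> edge_interior p f \<noteq> {}"
    using f by (auto simp: crossing_edges_def)
  obtain u v where uv: "e = {u, v}" "u < v" "v < n"
    using e(1) by (elim pairsE) (metis insert_commute lessThan_iff linorder_neqE_nat)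
  obtain w x where wx: "f = {w, x}" "w < x" "x < n"
    using f'(1) by (elim pairsE) (metis insert_commute lessThan_iff linorder_neqE_nat)
  have i: "u div m = i" "v div m = i" using e(2) uv by auto
  have out: "\<not> (w div m = i \<and> x div m = i)" using contra wx by auto
  have "e \<inter> f = {}" using crossing_edges_disjoint[OF gp e(1) f'(1)] f' by metis
  then have d: "u \<noteq> w" "u \<noteq> x" "v \<noteq> w" "v \<noteq> x" using uv wx by auto
  let ?o = "\<lambda>a b c. orient (p a) (p b) (p c)"
  have same: "?o a b c < 0" if "a < b" "b < c" "c < n" "a div m = c div m" for a b c
    using cl[unfolded clustered_def, rule_format, OF that(1-3)] that(4) by (simp add: turn_sign_def)
  have mixed: "?o a b c > 0" if "a < b" "b < c" "c < n" "a div m \<noteq> c div m" for a b c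
    using cl[unfolded clustered_def, rule_format, OF that(1-3)] that(4) by (simp add: turn_sign_def)
  have between: "t div m = i" if "u \<le> t" "t \<le> v" for t
    using div_le_mono[OF that(1), of m] div_le_mono[OF that(2), of m] i by simp
  have mono: "a div m \<le> b div m" if "a < b" for a b using that by (simp add: div_le_mono)
  have uv_disj: False if "?o u v w > 0" "?o u v x > 0"
    using same_side_disjoint[of "p u" "p v" "p w" "p x"] that f'(3) uv wx by auto
  have wx_disj: False if "?o w x u * ?o w x v > 0"
    using same_side_disjoint[of "p w" "p x" "p u" "p v"] that f'(3) uv wx by auto
  \<comment> \<open>Of the six possible orders, the nesting of \<open>f\<close> within
    \<open>e\<close> is absent, as it would put \<open>f\<close> into the block. In the first three
    cases \<open>u\<close> and \<open>v\<close> lie on the same side of \<open>f\<close>; in the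
    last two \<open>w\<close> and \<open>x\<close> lie on the same side of \<open>e\<close>.\<close>
  consider "x < u" | "v < w" | "w < u" "v < x" | "w < u" "u < x" "x < v" | "u < w" "w < v" "v < x"
    using d uv(2) wx(2) between[of w] between[of x] out by linarith
  then show False
  proof cases
    case 1
    then have "w div m \<noteq> u div m" using out i mono[of w x] mono[of x u] wx by auto
    then have "?o w x u > 0" "?o w x v > 0" using mixed[of w x u] mixed[of w x v] 1 wx uv i by auto
    then show False using wx_disj by simp
  next
    case 2
    then have "x div m \<noteq> u div m" using out i mono[of w x] mono[of v w] wx by auto
    then have "?o u w x > 0" "?o v w x > 0" using mixed[of u w x] mixed[of v w x] 2 wx uv i by auto
    then show False using wx_disj by (simp add: orient_cyclic)
  next
    case 3
    then have "w div m \<noteq> x div m" using out i mono[of w u] mono[of v x] by auto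
    then have "?o w u x > 0" "?o w v x > 0" using mixed[of w u x] mixed[of w v x] 3 wx uv i by auto
    then show False using wx_disj orient_swap(2)[of "p w" "p x" "p u"] orient_swap(2)[of "p w" "p x" "p v"] by simp
  next
    case 4
    then have "w div m \<noteq> i" using out between[of x] by auto
    then have "?o w u v > 0" "?o u x v < 0" using mixed[of w u v] same[of u x v] 4 uv i by auto
    then show False using uv_disj orient_swap(2)[of "p u" "p v" "p x"] by (simp add: orient_cyclic)
  next
    case 5
    then have "x div m \<noteq> i" using out between[of w] by auto
    then have "?o u v x > 0" "?o u w v < 0" using mixed[of u v x] same[of u w v] 5 wx uv i by auto
    then show False using uv_disj orient_swap(2)[of "p u" "p v" "p w"] by simp
  qed
qed

section \<open>Counting edges inside blocks\<close>

lemma card_pairs: "finite S \<Longrightarrow> card (pairs S) = card S choose 2"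
  by (simp add: pairs_def n_subsets)

text \<open>An edge inside a block is crossed only by edges of that block, hence at most
  \<open>m choose 2\<close> times; the \<open>n div m\<close> full blocks have disjoint edge
  sets.\<close>

lemma clustered_drawing_S_edges:
  assumes cl: "clustered m n p" and draw: "rectilinear_drawing {..<n} (pairs {..<n}) p"
    and m: "m > 0" "m choose 2 \<le> k"
  shows "(n div m) * (m choose 2) \<le> S_edges k (pairs {..<n}) p"
proof -
  let ?C = "\<lambda>i. {v. v div m = i}"
  have gp: "general_position {..<n} p" using draw by (simp add: rectilinear_drawing_iff)
  have C: "?C i = {i * m..<i * m + m}" for i
    using m(1) by (auto simp: div_nat_eqI dividend_less_times_div mult.commute)
      (metis add.commute dividend_less_times_div mult.commute)
  have cardC: "card (pairs (?C i)) = m choose 2" for i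
    by (simp add: C card_pairs)
  have sub: "?C i \<subseteq> {..<n}" if "i < n div m" for i
  proof -
    have "Suc i * m \<le> n" using that m(1) by (metis Suc_leI less_eq_div_iff_mult_less_eq)
    then show ?thesis unfolding C by auto
  qed
  have "card (crossings_on (pairs {..<n}) p e) \<le> k" if "i < n div m" "e \<in> pairs (?C i)" for i e
  proof -
    have e: "e \<in> pairs {..<n}" using that sub pairs_mono by blast
    have "crossing_edges {..<n} p e \<subseteq> pairs (?C i)"
    proof
      fix f assume f: "f \<in> crossing_edges {..<n} p e"
      have "\<forall>v\<in>e. v div m = i" using that(2) by (auto simp: pairs_def)
      then have "\<forall>v\<in>f. v div m = i" using clustered_crossing[OF cl gp e _ f] by blast
      then show "f \<in> pairs (?C i)" using f by (auto simp: crossing_edges_def pairs_def)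
    qed
    moreover have "finite (pairs (?C i))" by (simp add: C)
    ultimately have "card (crossing_edges {..<n} p e) \<le> m choose 2"
      using card_mono cardC by metis
    then show ?thesis using card_crossings_on_le[OF gp e] m(2) by simp
  qed
  then have "(\<Union>i<n div m. pairs (?C i)) \<subseteq> {e \<in> pairs {..<n}. card (crossings_on (pairs {..<n}) p e) \<le> k}"
    using pairs_mono[OF sub] by (intro UN_least subsetI CollectI conjI) auto
  then have "card (\<Union>i<n div m. pairs (?C i)) \<le> S_edges k (pairs {..<n}) p"
    unfolding S_edges_def by (intro card_mono) auto
  moreover have "card (\<Union>i<n div m. pairs (?C i)) = (\<Sum>i<n div m. card (pairs (?C i)))"
  proof (rule card_UN_disjoint)
    show "\<forall>i\<in>{..<n div m}. finite (pairs (?C i))" by (simp add: C)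
    show "\<forall>i\<in>{..<n div m}. \<forall>j\<in>{..<n div m}. i \<noteq> j \<longrightarrow> pairs (?C i) \<inter> pairs (?C j) = {}"
      by (force elim: pairsE)
  qed simp
  ultimately show ?thesis by (simp add: cardC)
qed

section \<open>Combining the two bounds\<close>

lemma S_edges_upper:
  fixes n k :: nat
  assumes "rectilinear_drawing {..<n} (pairs {..<n}) p" "1 \<le> k"
  shows "S_edges k (pairs {..<n}) p \<le> 12 * n * sqrt k"
proof -
  have gp: "general_position {..<n} p" "inj_on p {..<n}"
    using assms(1) by (simp_all add: rectilinear_drawing_iff)
  have "S_edges k (pairs {..<n}) p \<le> card {e \<in> pairs {..<n}. card (crossing_edges {..<n} p e) \<le> k}"
    unfolding S_edges_def
  proof (rule card_mono)
    show "{e \<in> pairs {..<n}. card (crossings_on (pairs {..<n}) p e) \<le> k}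
        \<subseteq> {e \<in> pairs {..<n}. card (crossing_edges {..<n} p e) \<le> k}"
      using card_crossing_edges_le[OF assms(1) _ finite_lessThan] by (auto intro: order_trans)
  qed simp
  also have "\<dots> \<le> 12 * n * sqrt k" using card_lightly_crossed[OF gp _ assms(2)] by simp
  finally show ?thesis by simp
qed

text \<open>The block size is \<open>sqrt k\<close> rounded down, plus 1. The bound on
  \<open>k\<close> gives \<open>2 * m \<le> n\<close>, so full blocks cover at least half of the
  points, and each covered point accounts for \<open>(m - 1) / 2\<close> edges, at least
  \<open>sqrt k / 4\<close>.\<close>

lemma cluster_size:
  fixes n k :: nat
  assumes "1 \<le> k" "1 \<le> n" "real k \<le> ((real n - 2) / 2) ^ 2"
  obtains m where "m > 0" "m choose 2 \<le> k" "real n * sqrt k / 8 \<le> (n div m) * (m choose 2)"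
proof -
  define j where "j = nat \<lfloor>sqrt k\<rfloor>"
  define m where "m = Suc j"
  have s1: "sqrt k \<ge> 1" using assms(1) by simp
  have j: "real j \<le> sqrt k" "sqrt k < j + 1" "1 \<le> j"
    using s1 by (simp_all add: j_def of_nat_nat le_nat_iff) linarith+
  \<comment> \<open>The square hides the sign of \<open>n - 2\<close>; for \<open>n = 1\<close> it
    equals 1/4, which is below \<open>k\<close>.\<close>
  have n2: "n \<ge> 2"
  proof (rule ccontr)
    assume "\<not> n \<ge> 2"
    then have "n = 1" using assms(2) by simp
    then show False using assms(1,3) by (simp add: power2_eq_square)
  qed
  then have "sqrt k \<le> (real n - 2) / 2"
    using real_sqrt_le_mono[OF assms(3)] by (simp add: real_sqrt_abs)
  then have mn: "2 * real m \<le> n" using j(1) by (simp add: m_def)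
  have c: "real (m choose 2) = real m * real j / 2"
  proof -
    have "2 * (m choose 2) = m * j"
      by (simp add: m_def choose_two)
    then have "2 * real (m choose 2) = real m * real j"
      by (metis of_nat_mult of_nat_numeral)
    then show ?thesis by simp
  qed
  have "real m \<le> sqrt k + sqrt k" using j(1) s1 unfolding m_def of_nat_Suc by linarith
  then have "real m * real j \<le> (sqrt k + sqrt k) * sqrt k"
    using j(1) by (intro mult_mono) auto
  also have "\<dots> = 2 * real k" by (simp add: algebra_simps)
  finally have 1: "m choose 2 \<le> k" using c by simp
  have "n < (n div m) * m + m"
    using mod_less_divisor[of m n] div_mult_mod_eq[of n m] unfolding m_def by linarith
  then have "real n \<le> real (n div m) * m + m"
    by (metis less_imp_le of_nat_add of_nat_le_iff of_nat_mult)
  then have "real n / 2 \<le> real (n div m) * m" using mn by simp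
  \<comment> \<open>Rounding down loses at most a factor 2:
    \<open>sqrt k < j + 1 \<le> 2 * j\<close>.\<close>
  moreover have "sqrt k / 4 \<le> real j / 2" using j by simp
  ultimately have "(real n / 2) * (sqrt k / 4) \<le> (real (n div m) * m) * (real j / 2)"
    by (intro mult_mono) auto
  then have "real n * sqrt k / 8 \<le> (n div m) * (m choose 2)" by (simp add: c)
  then show ?thesis using that[of m] 1 by (simp add: m_def)
qed

lemma max_S_bounds:
  fixes n k :: nat
  assumes nk: "1 \<le> n" "1 \<le> k" "real k \<le> ((real n - 2) / 2) ^ 2"
  shows "1 / 8 * real n * sqrt (real k) \<le> real (max_S k (complete_vertices n) (complete_edges n))"
    and "real (max_S k (complete_vertices n) (complete_edges n)) \<le> 12 * real n * sqrt (real k)"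
proof -
  let ?X = "{S_edges k (pairs {..<n}) p | p. rectilinear_drawing {..<n} (pairs {..<n}) p}"
  have maxS: "max_S k (complete_vertices n) (complete_edges n) = Max ?X"
    by (simp add: max_S_def complete_edges_eq complete_vertices_def)
  \<comment> \<open>\<open>Max\<close> needs a finite nonempty set: the values are bounded by the
    number of edges, and the clustered drawing below provides a member.\<close>
  have "?X \<subseteq> {..card (pairs {..<n})}"
    unfolding S_edges_def by (auto intro!: card_mono)
  then have fin: "finite ?X" by (rule finite_subset) simp
  obtain m where m: "m > 0" "m choose 2 \<le> k" "real n * sqrt k / 8 \<le> (n div m) * (m choose 2)"
    using cluster_size nk by metis
  obtain p where p: "clustered m n p" "rectilinear_drawing {..<n} (pairs {..<n}) p"
    using exists_clustered_drawing by blast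
  have mem: "S_edges k (pairs {..<n}) p \<in> ?X" using p by blast
  have "(n div m) * (m choose 2) \<le> Max ?X"
    using clustered_drawing_S_edges[OF p m(1,2)] Max_ge[OF fin mem] by linarith
  then have "real ((n div m) * (m choose 2)) \<le> real (Max ?X)" by (rule of_nat_mono)
  then show "1 / 8 * real n * sqrt (real k) \<le> real (max_S k (complete_vertices n) (complete_edges n))"
    unfolding maxS using m(3) by simp
  have "Max ?X \<in> ?X" using Max_in[OF fin] mem by blast
  then obtain q where "Max ?X = S_edges k (pairs {..<n}) q" "rectilinear_drawing {..<n} (pairs {..<n}) q"
    by blast
  then show "real (max_S k (complete_vertices n) (complete_edges n)) \<le> 12 * real n * sqrt (real k)"
    unfolding maxS using S_edges_upper[OF _ nk(2), of n q] by simp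
qed

theorem theorem5p1:
  "\<exists>c C :: real. 0 < c \<and> c \<le> C \<and>
     (\<forall>n k :: nat. 1 \<le> n \<longrightarrow> 1 \<le> k \<longrightarrow> real k \<le> ((real n - 2) / 2) ^ 2 \<longrightarrow>
        c * real n * sqrt (real k) \<le> real (max_S k (complete_vertices n) (complete_edges n)) \<and>
        real (max_S k (complete_vertices n) (complete_edges n)) \<le> C * real n * sqrt (real k))"
  using max_S_bounds by (intro exI[of _ "1 / 8"] exI[of _ 12] conjI allI impI) simp_all

end
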